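(* Let $k\ge2$ and let ${\bf a}=(a_n)_{n\ge0}$ be a $k$-automatic sequence over a finite totally ordered alphabet. Then the lexicographically least sequence in the reverse orbit closure of ${\bf a}$ is $k$-automatic.
   Context: A sequence $(a_n)_{n\ge0}$ over $\Delta$ is $k$-automatic if there is a deterministic finite automaton with output $M=(Q,\{0,\ldots,k-1\},\Delta,\delta,q_0,\tau)$ with $a_n=\tau(\delta(q_0,w^R))$ for every base-$k$ representation $w$ of $n$ (leading zeros allowed), $w^R$ the reversal of $w$. A sequence ${\bf b}=(b_n)_{n\ge0}$ lies in the reverse orbit closure of ${\bf a}$ if every finite prefix of ${\bf b}$ is a prefix of some word of the form $a_r a_{r-1}a_{r-2}\cdots a_1a_0$ ($r\ge0$). Sequences are compared lexicographically. *)

theory Defs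
  imports Main "HOL-Library.Sublist" "HOL-Library.Fun_Lexorder"
begin

record ('q, 'd) dfao =
  states :: "'q set"
  trans :: "'q \<Rightarrow> nat \<Rightarrow> 'q"
  start :: 'q
  out :: "'q \<Rightarrow> 'd"

definition is_dfao :: "nat \<Rightarrow> 'd set \<Rightarrow> ('q, 'd) dfao \<Rightarrow> bool" where
  "is_dfao k \<Delta> M \<longleftrightarrow>
     finite (states M) \<and> start M \<in> states M \<and>
     (\<forall>q\<in>states M. \<forall>c<k. trans M q c \<in> states M) \<and>
     (\<forall>q\<in>states M. out M q \<in> \<Delta>)"

text \<open>Words are written most significant digit first, whereas \<^const>\<open>horner_sum\<close> expects the
  least significant digit first. Leading zeros are allowed; the empty word represents 0.\<close>

definition base_rep :: "nat \<Rightarrow> nat list \<Rightarrow> nat \<Rightarrow> bool" where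
  "base_rep k w n \<longleftrightarrow> set w \<subseteq> {..<k} \<and> horner_sum id k (rev w) = n"

definition generates :: "nat \<Rightarrow> ('q, 'd) dfao \<Rightarrow> (nat \<Rightarrow> 'd) \<Rightarrow> bool" where
  "generates k M a \<longleftrightarrow>
     (\<forall>n w. base_rep k w n \<longrightarrow> a n = out M (foldl (trans M) (start M) (rev w)))"

text \<open>HOL cannot quantify existentially over the type of states, so states are taken to be natural
  numbers; by lemma \<open>automaticI\<close> below this is no restriction.\<close>

definition automatic :: "nat \<Rightarrow> 'd set \<Rightarrow> (nat \<Rightarrow> 'd) \<Rightarrow> bool" where
  "automatic k \<Delta> a \<longleftrightarrow> (\<exists>M :: (nat, 'd) dfao. is_dfao k \<Delta> M \<and> generates k M a)"

lemma automaticI: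
  fixes M :: "('q, 'd) dfao"
  assumes M: "is_dfao k \<Delta> M" and gen: "generates k M a"
  shows "automatic k \<Delta> a"
proof -
  from M have "finite (states M)" by (simp add: is_dfao_def)
  then obtain f :: "'q \<Rightarrow> nat" where f: "inj_on f (states M)"
    using finite_imp_inj_to_nat_seg by blast
  define g where "g = inv_into (states M) f"
  have gf: "g (f q) = q" if "q \<in> states M" for q
    using f that by (simp add: g_def)
  define N :: "(nat, 'd) dfao" where
    "N = \<lparr>states = f ` states M, trans = (\<lambda>q c. f (trans M (g q) c)),
          start = f (start M), out = (\<lambda>q. out M (g q))\<rparr>"
  have "is_dfao k \<Delta> N"
    using M by (auto simp: is_dfao_def N_def gf)
  moreover have run: "q \<in> states M \<Longrightarrow> set u \<subseteq> {..<k} \<Longrightarrow>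
      foldl (trans M) q u \<in> states M \<and>
      foldl (trans N) (f q) u = f (foldl (trans M) q u)" for q u
  proof (induction u arbitrary: q)
    case (Cons c u)
    then have "trans M q c \<in> states M" using M by (auto simp: is_dfao_def)
    with Cons show ?case by (simp add: N_def gf)
  qed simp
  have "generates k N a"
    unfolding generates_def
  proof (intro allI impI)
    fix n w assume w: "base_rep k w n"
    have s: "start M \<in> states M" using M by (simp add: is_dfao_def)
    have r: "set (rev w) \<subseteq> {..<k}" using w by (simp add: base_rep_def)
    have "out N (foldl (trans N) (start N) (rev w))
        = out N (f (foldl (trans M) (start M) (rev w)))"
      using run[OF s r] by (simp add: N_def)
    also have "\<dots> = out M (foldl (trans M) (start M) (rev w))"
      using run[OF s r] by (simp add: N_def gf)
    finally show "a n = out N (foldl (trans N) (start N) (rev w))"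
      using gen w by (simp add: generates_def)
  qed
  ultimately show ?thesis by (auto simp: automatic_def)
qed

definition reverse_orbit_closure :: "(nat \<Rightarrow> 'd) \<Rightarrow> (nat \<Rightarrow> 'd) set" where
  "reverse_orbit_closure a =
     {b. \<forall>m. \<exists>r. prefix (map b [0..<m]) (map a (rev [0..<Suc r]))}"

definition lex_least :: "(nat \<Rightarrow> 'd::linorder) set \<Rightarrow> (nat \<Rightarrow> 'd) \<Rightarrow> bool" where
  "lex_least S b \<longleftrightarrow> b \<in> S \<and> (\<forall>c\<in>S. b = c \<or> less_fun b c)"

end

theory Submission
  imports Defs "HOL-Library.Infinite_Set"
begin

text \<open>A sequence is \<open>k\<close>-automatic iff its kernel of subsequences \<open>a (k ^ e * n + r)\<close> with
  \<open>r < k ^ e\<close> is finite. For functions of several variables, having a finite kernel is preserved by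
  pointwise operations and by quantification over a variable, so everything first-order definable
  from addition, order and \<open>a\<close> is automatic.

  A sequence lies in the reverse orbit closure iff each of its prefixes, reversed, occurs infinitely
  often in \<open>a\<close>. Hence the least element is obtained greedily, and its letter at \<open>n\<close> is the \<open>c\<close>
  for which there is an \<open>N\<close> such that for infinitely many \<open>p\<close> one has \<open>a p = c\<close> and
  \<open>a (p + n) \<dots> a p\<close> is at most \<open>a (q + n) \<dots> a q\<close> for all \<open>q \<ge> N\<close>: this is first-order. The
  restriction to large \<open>q\<close> discards the words that cannot be extended indefinitely.\<close>

section \<open>Finite kernels\<close>

definition kernel :: "nat \<Rightarrow> (nat \<Rightarrow> 'a) \<Rightarrow> (nat \<Rightarrow> 'a) set" where
  "kernel k a = {\<lambda>n. a (k ^ e * n + r) | e r. r < k ^ e}"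

text \<open>The arguments of a function of several variables are bundled into an environment
  \<open>v :: 'i \<Rightarrow> nat\<close>, so that quantifying over a variable does not change the type.\<close>

definition env_kernel :: "nat \<Rightarrow> (('i \<Rightarrow> nat) \<Rightarrow> 'a) \<Rightarrow> (('i \<Rightarrow> nat) \<Rightarrow> 'a) set" where
  "env_kernel k f = {\<lambda>v. f (\<lambda>i. k ^ e * v i + r i) | e r. \<forall>i. r i < k ^ e}"

lemma kernelI: "r < k ^ e \<Longrightarrow> (\<lambda>n. a (k ^ e * n + r)) \<in> kernel k a"
  unfolding kernel_def by blast

lemma env_kernelI: "(\<And>i. r i < k ^ e) \<Longrightarrow> (\<lambda>v. f (\<lambda>i. k ^ e * v i + r i)) \<in> env_kernel k f"
  unfolding env_kernel_def by blast

section \<open>Automata and finite kernels of sequences\<close>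

lemma horner_sum_id_Cons: "horner_sum id k (c # u) = c + k * horner_sum id k u"
  by (simp add: id_def)

lemma digits_exist:
  fixes k r :: nat
  assumes "r < k ^ e"
  shows "\<exists>u. length u = e \<and> set u \<subseteq> {..<k} \<and> horner_sum id k u = r"
  using assms
proof (induction e arbitrary: r)
  case 0
  then show ?case by simp
next
  case (Suc e)
  from Suc.prems have k: "k > 0" by (cases "k = 0") auto
  have "r div k < k ^ e"
    using Suc.prems k by (simp add: div_less_iff_less_mult mult.commute)
  then obtain u where u: "length u = e" "set u \<subseteq> {..<k}" "horner_sum id k u = r div k"
    using Suc.IH by blast
  show ?case
    by (rule exI[of _ "(r mod k) # u"])
      (use u k in \<open>auto simp: horner_sum_id_Cons simp del: horner_sum_simps(2) id_apply\<close>)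
qed

lemma dfao_run:
  assumes "is_dfao k \<Delta> M" "q \<in> states M" "set u \<subseteq> {..<k}"
  shows "foldl (trans M) q u \<in> states M"
  using assms by (induction u arbitrary: q) (auto simp: is_dfao_def)

lemma automatic_range:
  assumes "k \<ge> 2" "automatic k \<Delta> a"
  shows "a n \<in> \<Delta>"
proof -
  obtain M :: "(nat, 'a) dfao" where M: "is_dfao k \<Delta> M" "generates k M a"
    using assms(2) by (auto simp: automatic_def)
  obtain u where u: "set u \<subseteq> {..<k}" "horner_sum id k u = n"
    using digits_exist[of n k n] power_gt_expt[of k n] assms(1) by auto
  have "a n = out M (foldl (trans M) (start M) u)"
    using M(2) u unfolding generates_def base_rep_def by (metis rev_rev_ident set_rev)
  then show ?thesis
    using M(1) dfao_run[OF M(1), of "start M" u] u by (auto simp: is_dfao_def)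
qed

text \<open>Reading the \<open>e\<close> low digits of an index first, padded with zeros to that
  length, leads to a state that determines the whole subsequence. Hence there are at most as many
  kernel elements as states.\<close>

lemma automatic_finite_kernel:
  assumes "k \<ge> 2" "automatic k \<Delta> a"
  shows "finite (kernel k a)"
proof -
  obtain M :: "(nat, 'a) dfao" where M: "is_dfao k \<Delta> M" "generates k M a"
    using assms(2) by (auto simp: automatic_def)
  have "\<exists>u. set u \<subseteq> {..<k} \<and> horner_sum id k u = n" for n
    using digits_exist[of n k n] power_gt_expt[of k n] assms(1) by auto
  then obtain dig where dig: "set (dig n) \<subseteq> {..<k}" "horner_sum id k (dig n) = n" for n
    by metis
  have "kernel k a \<subseteq> (\<lambda>q n. out M (foldl (trans M) q (dig n))) ` states M"
  proof
    fix f assume "f \<in> kernel k a"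
    then obtain e r where f: "f = (\<lambda>n. a (k ^ e * n + r))" and r: "r < k ^ e"
      by (auto simp: kernel_def)
    obtain u where u: "length u = e" "set u \<subseteq> {..<k}" "horner_sum id k u = r"
      using digits_exist[OF r] by blast
    have "f n = out M (foldl (trans M) (foldl (trans M) (start M) u) (dig n))" for n
    proof -
      have "base_rep k (rev (u @ dig n)) (k ^ e * n + r)"
        using u dig[of n] by (auto simp: base_rep_def horner_sum_append simp del: rev_append)
      then have "f n = out M (foldl (trans M) (start M) (rev (rev (u @ dig n))))"
        using M(2) unfolding generates_def f by blast
      then show ?thesis by simp
    qed
    then have "f = (\<lambda>n. out M (foldl (trans M) (foldl (trans M) (start M) u) (dig n)))"
      by blast
    moreover have "foldl (trans M) (start M) u \<in> states M"
      using dfao_run[OF M(1)] u M(1) by (auto simp: is_dfao_def)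
    ultimately show "f \<in> (\<lambda>q n. out M (foldl (trans M) q (dig n))) ` states M"
      by blast
  qed
  moreover have "finite (states M)"
    using M(1) by (simp add: is_dfao_def)
  ultimately show ?thesis
    using finite_surj by blast
qed

text \<open>The kernel itself is the state set: reading a digit passes to a subsequence, and after
  all digits of \<open>n\<close>, least significant first, the value at 0 is
  \<open>b n\<close>.\<close>

lemma finite_kernel_automatic:
  assumes "finite (kernel k b)" "\<And>n. b n \<in> \<Delta>"
  shows "automatic k \<Delta> b"
proof -
  define M :: "(nat \<Rightarrow> 'a, 'a) dfao" where
    "M = \<lparr>states = kernel k b, trans = (\<lambda>f c n. f (k * n + c)), start = b, out = (\<lambda>f. f 0)\<rparr>"
  have "b \<in> kernel k b"
    unfolding kernel_def by (rule CollectI, rule exI[of _ 0], rule exI[of _ 0]) simp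
  moreover have "(\<lambda>n. f (k * n + c)) \<in> kernel k b" if f: "f \<in> kernel k b" and c: "c < k" for f c
  proof -
    obtain e r where f: "f = (\<lambda>n. b (k ^ e * n + r))" and r: "r < k ^ e"
      using f by (auto simp: kernel_def)
    have "k ^ e * c + r < k ^ e * (c + 1)"
      using r by simp
    also have "\<dots> \<le> k ^ e * k"
      using c by (intro mult_left_mono) auto
    finally have "k ^ e * c + r < k ^ Suc e"
      by (simp add: mult.commute)
    moreover have "(\<lambda>n. f (k * n + c)) = (\<lambda>n. b (k ^ Suc e * n + (k ^ e * c + r)))"
      by (simp add: f algebra_simps)
    ultimately show ?thesis
      unfolding kernel_def by blast
  qed
  ultimately have "is_dfao k \<Delta> M"
    using assms by (auto simp: is_dfao_def M_def kernel_def)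
  moreover have run: "foldl (trans M) f u = (\<lambda>n. f (k ^ length u * n + horner_sum id k u))" for f u
    by (induction u arbitrary: f) 
      (simp_all add: M_def horner_sum_id_Cons algebra_simps del: horner_sum_simps(2) id_apply)
  have "generates k M b"
    unfolding generates_def run by (auto simp: base_rep_def M_def)
  ultimately show ?thesis
    by (rule automaticI)
qed

section \<open>Closure properties of finite kernels in several variables\<close>

text \<open>Giving all variables the same residue and then the same value recovers every element of
  the one-variable kernel.\<close>

lemma finite_kernel_of_env:
  assumes "finite (env_kernel k (\<lambda>v :: 'i \<Rightarrow> nat. b (v j)))"
  shows "finite (kernel k b)"
proof -
  have "kernel k b \<subseteq> (\<lambda>f n. f (\<lambda>_. n)) ` env_kernel k (\<lambda>v :: 'i \<Rightarrow> nat. b (v j))"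
  proof
    fix f assume "f \<in> kernel k b"
    then obtain e r where f: "f = (\<lambda>n. b (k ^ e * n + r))" and r: "r < k ^ e"
      by (auto simp: kernel_def)
    have "(\<lambda>v :: 'i \<Rightarrow> nat. b (k ^ e * v j + r)) \<in> env_kernel k (\<lambda>v. b (v j))"
      using env_kernelI[of "\<lambda>_. r" k e "\<lambda>v. b (v j)"] r by simp
    then show "f \<in> (\<lambda>f n. f (\<lambda>_. n)) ` env_kernel k (\<lambda>v :: 'i \<Rightarrow> nat. b (v j))"
      unfolding f by (rule rev_image_eqI) simp
  qed
  then show ?thesis
    by (rule finite_surj[rotated]) (use assms in auto)
qed

lemma env_kernel_var:
  assumes "finite (kernel k a)"
  shows "finite (env_kernel k (\<lambda>v. a (v i)))"
proof -
  have "env_kernel k (\<lambda>v. a (v i)) \<subseteq> (\<lambda>f v. f (v i)) ` kernel k a"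
  proof
    fix g assume "g \<in> env_kernel k (\<lambda>v. a (v i))"
    then obtain e r where g: "g = (\<lambda>v. a (k ^ e * v i + r i))" and "r i < k ^ e"
      by (auto simp: env_kernel_def)
    then show "g \<in> (\<lambda>f v. f (v i)) ` kernel k a"
      unfolding g by (intro image_eqI[where x = "\<lambda>n. a (k ^ e * n + r i)"] refl kernelI)
  qed
  then show ?thesis
    by (rule finite_surj[rotated]) (use assms in auto)
qed

text \<open>Adding the residues produces a new residue \<open>t\<close> and a carry
  \<open>c\<close>, which is 0 or 1. The kernel element depends only on the carry and on one element
  of \<open>kernel k a\<close>.\<close>

lemma env_kernel_add:
  assumes "finite (kernel k a)"
  shows "finite (env_kernel k (\<lambda>v. a (v i + v j)))"
proof -
  have "env_kernel k (\<lambda>v. a (v i + v j))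
      \<subseteq> (\<lambda>(f, c) v. f (v i + v j + c)) ` (kernel k a \<times> {..<2})"
  proof
    fix g assume "g \<in> env_kernel k (\<lambda>v. a (v i + v j))"
    then obtain e r where g: "g = (\<lambda>v. a (k ^ e * v i + r i + (k ^ e * v j + r j)))"
      and r: "\<forall>i. r i < k ^ e"
      by (auto simp: env_kernel_def)
    define c t where "c = (r i + r j) div k ^ e" and "t = (r i + r j) mod k ^ e"
    have pos: "k ^ e > 0"
      using r by (metis gr_zeroI not_less_zero)
    have "r i + r j < 2 * k ^ e"
      using r[rule_format, of i] r[rule_format, of j] by linarith
    then have "c < 2"
      using pos by (simp add: c_def div_less_iff_less_mult)
    moreover have "t < k ^ e"
      using pos by (simp add: t_def)
    then have "(\<lambda>n. a (k ^ e * n + t)) \<in> kernel k a"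
      by (rule kernelI)
    moreover have "k ^ e * v i + r i + (k ^ e * v j + r j) = k ^ e * (v i + v j + c) + t" for v
    proof -
      have "r i + r j = k ^ e * c + t"
        by (simp add: c_def t_def)
      then show ?thesis
        by (simp add: algebra_simps)
    qed
    ultimately show "g \<in> (\<lambda>(f, c) v. f (v i + v j + c)) ` (kernel k a \<times> {..<2})"
      by (intro image_eqI[where x = "(\<lambda>n. a (k ^ e * n + t), c)"]) (auto simp: g)
  qed
  then show ?thesis
    by (rule finite_surj[rotated]) (use assms in auto)
qed

text \<open>The quotients decide the comparison unless they agree; in that case the residues do. So
  only the strict and the weak order occur in the kernel.\<close>

lemma env_kernel_less: "finite (env_kernel k (\<lambda>v. v i < v j))"
proof -
  have "g = (\<lambda>v. v i < v j) \<or> g = (\<lambda>v. v i \<le> v j)"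
    if mem: "g \<in> env_kernel k (\<lambda>v. v i < v j)" for g
  proof -
    obtain e r where g: "g = (\<lambda>v. k ^ e * v i + r i < k ^ e * v j + r j)"
      and r: "\<forall>i. r i < k ^ e"
      using mem unfolding env_kernel_def by blast
    have strict: "k ^ e * x + r p < k ^ e * y + r q" if "x < y" for x y p q
    proof -
      have "k ^ e * (x + 1) \<le> k ^ e * y"
        using that by (intro mult_left_mono) auto
      then show ?thesis
        using r[rule_format, of p] by simp
    qed
    have "g v = (v i < v j \<or> v i = v j \<and> r i < r j)" for v
    proof (cases "v i" "v j" rule: linorder_cases)
      case less
      then show ?thesis
        using strict[OF less, of i j] by (simp only: g simp_thms)
    next
      case equal
      then show ?thesis
        by (simp add: g)
    next
      case greater
      then show ?thesis
        unfolding g using strict[OF greater, of j i] by (metis less_asym less_irrefl)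
    qed
    then have "g = (\<lambda>v. v i < v j \<or> v i = v j \<and> r i < r j)"
      by (rule ext)
    then show ?thesis
      by (cases "r i < r j") (simp_all add: le_less)
  qed
  then have "env_kernel k (\<lambda>v. v i < v j) \<subseteq> {\<lambda>v. v i < v j, \<lambda>v. v i \<le> v j}"
    by blast
  then show ?thesis
    by (rule finite_subset) simp
qed

lemma env_kernel_comb:
  assumes "finite (env_kernel k f)" "finite (env_kernel k g)"
  shows "finite (env_kernel k (\<lambda>v. h (f v) (g v)))"
proof -
  have "env_kernel k (\<lambda>v. h (f v) (g v))
      \<subseteq> (\<lambda>(f, g) v. h (f v) (g v)) ` (env_kernel k f \<times> env_kernel k g)"
  proof
    fix u assume "u \<in> env_kernel k (\<lambda>v. h (f v) (g v))"
    then obtain e r where 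
      u: "u = (\<lambda>v. h (f (\<lambda>i. k ^ e * v i + r i)) (g (\<lambda>i. k ^ e * v i + r i)))"
      and r: "\<forall>i. r i < k ^ e"
      by (auto simp: env_kernel_def)
    then show "u \<in> (\<lambda>(f, g) v. h (f v) (g v)) ` (env_kernel k f \<times> env_kernel k g)"
      by (intro image_eqI[where x = "(\<lambda>v. f (\<lambda>i. k ^ e * v i + r i), \<lambda>v. g (\<lambda>i. k ^ e * v i + r i))"])
        (auto simp: u intro: env_kernelI)
  qed
  then show ?thesis
    by (rule finite_surj[rotated]) (use assms in auto)
qed

lemma env_kernel_map:
  assumes "finite (env_kernel k f)"
  shows "finite (env_kernel k (\<lambda>v. h (f v)))"
  using env_kernel_comb[OF assms assms, of "\<lambda>x _. h x"] .

text \<open>An arbitrary \<open>H\<close> covers both quantifiers and unions. Splitting the bound variable as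
  \<open>x = k ^ e * y + s\<close> shows that a kernel element depends only on a subset of the kernel of \<open>f\<close>.\<close>

lemma env_kernel_range:
  assumes "finite (env_kernel k f)"
  shows "finite (env_kernel k (\<lambda>v. H (range (\<lambda>x. f (v(j := x))))))"
proof -
  have "env_kernel k (\<lambda>v. H (range (\<lambda>x. f (v(j := x)))))
      \<subseteq> (\<lambda>S v. H (\<Union>g\<in>S. range (\<lambda>y. g (v(j := y))))) ` Pow (env_kernel k f)"
  proof
    fix u assume "u \<in> env_kernel k (\<lambda>v. H (range (\<lambda>x. f (v(j := x)))))"
    then obtain e r where
      u: "u = (\<lambda>v. H (range (\<lambda>x. f ((\<lambda>i. k ^ e * v i + r i)(j := x)))))"
      and r: "\<forall>i. r i < k ^ e"
      by (auto simp: env_kernel_def)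
    have pos: "k ^ e > 0"
      using r by (metis gr_zeroI not_less_zero)
    \<comment> \<open>\<open>K s\<close> fixes the residue of the bound variable to
      \<open>s\<close>; the quotient \<open>y\<close> of the bound variable remains to be
      quantified.\<close>
    define K where "K s = (\<lambda>v. f (\<lambda>i. k ^ e * v i + (r(j := s)) i))" for s
    have upd: "f ((\<lambda>i. k ^ e * v i + r i)(j := k ^ e * y + s)) = K s (v(j := y))" for v y s
      unfolding K_def by (rule arg_cong[of _ _ f]) auto
    have "range (\<lambda>x. f ((\<lambda>i. k ^ e * v i + r i)(j := x)))
        = (\<Union>g\<in>K ` {..<k ^ e}. range (\<lambda>y. g (v(j := y))))" (is "?L = ?R") for v
    proof
      show "?L \<subseteq> ?R"
      proof
        fix z assume "z \<in> ?L"
        then obtain x where "z = f ((\<lambda>i. k ^ e * v i + r i)(j := x))"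
          by blast
        then have "z = K (x mod k ^ e) (v(j := x div k ^ e))"
          using upd[of v "x div k ^ e" "x mod k ^ e"] by simp
        moreover have "x mod k ^ e \<in> {..<k ^ e}"
          using pos by simp
        ultimately show "z \<in> ?R"
          by blast
      qed
      show "?R \<subseteq> ?L"
        by (auto simp: upd[symmetric])
    qed
    then have "u = (\<lambda>v. H (\<Union>g\<in>K ` {..<k ^ e}. range (\<lambda>y. g (v(j := y)))))"
      by (simp add: u)
    moreover have "K s \<in> env_kernel k f" if "s < k ^ e" for s
      unfolding K_def by (rule env_kernelI) (use r that in auto)
    then have "K ` {..<k ^ e} \<in> Pow (env_kernel k f)"
      by blast
    ultimately show "u \<in> (\<lambda>S v. H (\<Union>g\<in>S. range (\<lambda>y. g (v(j := y))))) ` Pow (env_kernel k f)"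
      by blast
  qed
  then show ?thesis
    by (rule finite_surj[rotated]) (use assms in auto)
qed

lemma env_kernel_all:
  assumes "finite (env_kernel k f)"
  shows "finite (env_kernel k (\<lambda>v. \<forall>x. f (v(j := x))))"
proof -
  \<comment> \<open>A universal statement is a property of the set of truth values attained, as
    \<open>env_kernel_range\<close> requires.\<close>
  have "(\<lambda>v. \<forall>x. f (v(j := x))) = (\<lambda>v. False \<notin> range (\<lambda>x. f (v(j := x))))"
    by (auto simp: fun_eq_iff)
  then show ?thesis
    using env_kernel_range[OF assms, of "\<lambda>X. False \<notin> X" j] by simp
qed

section \<open>The least sequence\<close>

definition revocc :: "(nat \<Rightarrow> 'd) \<Rightarrow> (nat \<Rightarrow> 'd) \<Rightarrow> nat \<Rightarrow> nat set" where
  "revocc a b n = {r. \<forall>j<n. a (r - j) = b j}"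

lemma revocc_Suc: "revocc a b (Suc n) = {r \<in> revocc a b n. a (r - n) = b n}"
  by (auto simp: revocc_def less_Suc_eq)

lemma revocc_antimono: "m \<le> n \<Longrightarrow> revocc a b n \<subseteq> revocc a b m"
  by (auto simp: revocc_def)

lemma prefix_map_rev_iff:
  "prefix (map b [0..<m]) (map a (rev [0..<Suc r])) \<longleftrightarrow> m \<le> Suc r \<and> r \<in> revocc a b m"
proof -
  have nth: "map a (rev [0..<Suc r]) ! j = a (r - j)" if "j \<le> r" for j
    using that by (simp add: rev_nth del: upt_Suc)
  have "prefix xs ys \<longleftrightarrow> length xs \<le> length ys \<and> (\<forall>j<length xs. xs ! j = ys ! j)"
    for xs ys :: "'a list"
  proof
    assume "length xs \<le> length ys \<and> (\<forall>j<length xs. xs ! j = ys ! j)"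
    then have "xs = take (length xs) ys"
      by (intro nth_equalityI) auto
    then show "prefix xs ys"
      by (metis take_is_prefix)
  qed (auto simp: prefix_def nth_append)
  then show ?thesis
    using nth by (auto simp: revocc_def simp del: upt_Suc)
qed

text \<open>Positions \<open>r < n\<close> in \<open>revocc a b n\<close> are spurious because of truncated subtraction; they do
  not matter, since only infinitely many occurrences count.\<close>

lemma reverse_orbit_closure_iff:
  "b \<in> reverse_orbit_closure a \<longleftrightarrow> (\<forall>n. infinite (revocc a b n))"
proof
  assume b: "b \<in> reverse_orbit_closure a"
  show "\<forall>n. infinite (revocc a b n)"
    unfolding infinite_nat_iff_unbounded_le
  proof (intro allI)
    fix n m
    \<comment> \<open>A prefix longer than \<open>n\<close> is used only to force
      \<open>r \<ge> m\<close>.\<close>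
    obtain r where "n + m + 1 \<le> Suc r" "r \<in> revocc a b (n + m + 1)"
      using b unfolding reverse_orbit_closure_def prefix_map_rev_iff by blast
    then show "\<exists>r\<ge>m. r \<in> revocc a b n"
      using revocc_antimono[of n "n + m + 1" a b] by (intro exI[of _ r]) auto
  qed
next
  assume inf: "\<forall>n. infinite (revocc a b n)"
  show "b \<in> reverse_orbit_closure a"
    unfolding reverse_orbit_closure_def prefix_map_rev_iff
    using inf unfolding infinite_nat_iff_unbounded_le by (blast intro: le_SucI)
qed

section \<open>The greedy sequence and its minimality\<close>

text \<open>Each letter depends on all earlier ones, so the recursion builds words;
  \<open>greedy_eq_Min\<close> restates it for the sequence \<open>greedy\<close>.\<close>

primrec greedy_word :: "(nat \<Rightarrow> 'd::linorder) \<Rightarrow> nat \<Rightarrow> 'd list" where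
  "greedy_word a 0 = []"
| "greedy_word a (Suc n) = greedy_word a n @
     [Min {c. infinite {r \<in> revocc a ((!) (greedy_word a n)) n. a (r - n) = c}}]"

definition greedy :: "(nat \<Rightarrow> 'd::linorder) \<Rightarrow> nat \<Rightarrow> 'd" where
  "greedy a n = greedy_word a (Suc n) ! n"

lemma length_greedy_word [simp]: "length (greedy_word a n) = n"
  by (induction n) auto

lemma greedy_word_nth: "j < n \<Longrightarrow> greedy_word a n ! j = greedy a j"
  by (induction n) (auto simp: greedy_def nth_append less_Suc_eq)

lemma greedy_eq_Min:
  "greedy a n = Min {c. infinite {r \<in> revocc a (greedy a) n. a (r - n) = c}}"
proof -
  have "revocc a ((!) (greedy_word a n)) n = revocc a (greedy a) n"
    by (auto simp: revocc_def greedy_word_nth)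
  then show ?thesis
    by (simp add: greedy_def nth_append)
qed

text \<open>Pigeonhole principle over the finitely many letters.\<close>

lemma infinite_letter:
  assumes "finite (range a)" "infinite {r \<in> A. P (a (r - n :: nat))}"
  shows "\<exists>c. P c \<and> infinite {r \<in> A. a (r - n) = c}"
proof (rule ccontr)
  assume "\<not> ?thesis"
  then have "finite (\<Union>c\<in>{c \<in> range a. P c}. {r \<in> A. a (r - n) = c})"
    using assms(1) by auto
  moreover have "{r \<in> A. P (a (r - n))} \<subseteq> (\<Union>c\<in>{c \<in> range a. P c}. {r \<in> A. a (r - n) = c})"
    by auto
  ultimately show False
    using assms(2) finite_subset by blast
qed

lemma finite_recurrent_letters:
  assumes "finite (range a)"
  shows "finite {c. infinite {r \<in> A. a (r - n :: nat) = c}}"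
  by (rule finite_subset[OF _ assms]) (auto dest: infinite_imp_nonempty)

lemma infinite_revocc_greedy:
  assumes "finite (range a)"
  shows "infinite (revocc a (greedy a) n)"
proof (induction n)
  case 0
  then show ?case by (simp add: revocc_def)
next
  case (Suc n)
  let ?C = "{c. infinite {r \<in> revocc a (greedy a) n. a (r - n) = c}}"
  have "?C \<noteq> {}"
    using infinite_letter[OF assms, of "revocc a (greedy a) n" "\<lambda>_. True" n] Suc by auto
  then have "Min ?C \<in> ?C"
    using finite_recurrent_letters[OF assms] by (intro Min_in) auto
  then show ?case
    by (simp add: revocc_Suc greedy_eq_Min[symmetric])
qed

text \<open>Otherwise a single smaller letter would extend the greedy prefix infinitely often,
  contradicting the choice of the minimum.\<close>

lemma finite_less_greedy:
  assumes "finite (range a)"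
  shows "finite {r \<in> revocc a (greedy a) n. a (r - n) < greedy a n}"
proof (rule ccontr)
  assume "infinite {r \<in> revocc a (greedy a) n. a (r - n) < greedy a n}"
  from infinite_letter[OF assms this]
  obtain c where c: "c < greedy a n" "infinite {r \<in> revocc a (greedy a) n. a (r - n) = c}"
    by blast
  then have "greedy a n \<le> c"
    unfolding greedy_eq_Min[of a n] using finite_recurrent_letters[OF assms] by (intro Min_le) auto
  with c(1) show False by simp
qed

text \<open>At the first index where a competitor \<open>c\<close> differs, its letter extends the
  common prefix infinitely often, so by \<open>finite_less_greedy\<close> it cannot be the smaller
  one.\<close>

lemma lex_least_greedy:
  assumes "finite (range a)"
  shows "lex_least (reverse_orbit_closure a) (greedy a)"
  unfolding lex_least_def
proof (intro conjI ballI)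
  show "greedy a \<in> reverse_orbit_closure a"
    using infinite_revocc_greedy[OF assms] by (simp add: reverse_orbit_closure_iff)
next
  fix c assume c: "c \<in> reverse_orbit_closure a"
  show "greedy a = c \<or> less_fun (greedy a) c"
  proof (cases "greedy a = c")
    case False
    then have "\<exists>n. greedy a n \<noteq> c n"
      by auto
    then obtain n where n: "greedy a n \<noteq> c n" and below: "\<forall>j<n. greedy a j = c j"
      using exists_least_iff[of "\<lambda>n. greedy a n \<noteq> c n"] by auto
    have "revocc a c (Suc n) = {r \<in> revocc a (greedy a) n. a (r - n) = c n}"
      unfolding revocc_Suc using below by (auto simp: revocc_def)
    then have inf: "infinite {r \<in> revocc a (greedy a) n. a (r - n) = c n}"
      using c unfolding reverse_orbit_closure_iff by metis
    have "\<not> c n < greedy a n"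
    proof
      assume "c n < greedy a n"
      then have "{r \<in> revocc a (greedy a) n. a (r - n) = c n}
          \<subseteq> {r \<in> revocc a (greedy a) n. a (r - n) < greedy a n}"
        by auto
      then show False
        using inf finite_less_greedy[OF assms] finite_subset by blast
    qed
    then have "greedy a n < c n"
      using n by simp
    then show ?thesis
      using below by (auto simp: less_fun_def)
  qed simp
qed

lemma lex_least_unique:
  assumes "lex_least S b" "lex_least S c"
  shows "b = c"
  using assms less_fun_asym[of b c] unfolding lex_least_def by metis

section \<open>The least sequence is definable\<close>

text \<open>Compares the words of length \<open>n + 1\<close> starting at \<open>p\<close> and \<open>q\<close>, read from right to left.\<close>

definition window_le :: "(nat \<Rightarrow> 'd::linorder) \<Rightarrow> nat \<Rightarrow> nat \<Rightarrow> nat \<Rightarrow> bool" where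
  "window_le a n p q \<longleftrightarrow>
     (\<forall>j. j \<le> n \<longrightarrow> (\<forall>i. j < i \<and> i \<le> n \<longrightarrow> a (p + i) = a (q + i)) \<longrightarrow> a (p + j) \<le> a (q + j))"

lemma window_le_antisym:
  assumes "window_le a n p q" "window_le a n q p"
  shows "a p = a q"
proof -
  \<comment> \<open>Here \<open>m\<close> is the distance from the right end, where the comparison
    begins.\<close>
  have "a (p + (n - m)) = a (q + (n - m))" if "m \<le> n" for m
    using that
  proof (induction m rule: less_induct)
    case (less m)
    have "a (p + i) = a (q + i)" if "n - m < i" "i \<le> n" for i
      using less.IH[of "n - i"] less.prems that by simp
    then show ?case
      using assms unfolding window_le_def by (metis diff_le_self order_antisym)
  qed
  from this[of n] show ?thesis by simp
qed

text \<open>The window at \<open>p\<close> spells the greedy prefix. If the window at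
  \<open>q\<close> were smaller at the first disagreement from the right, \<open>q + n\<close> would
  be one of the excluded positions.\<close>

lemma window_le_greedy:
  assumes "p + n \<in> revocc a (greedy a) (Suc n)"
    and "\<And>t. t \<le> n \<Longrightarrow> q + n \<notin> {r \<in> revocc a (greedy a) t. a (r - t) < greedy a t}"
  shows "window_le a n p q"
  unfolding window_le_def
proof (intro allI impI)
  fix j assume j: "j \<le> n" and eq: "\<forall>i. j < i \<and> i \<le> n \<longrightarrow> a (p + i) = a (q + i)"
  have p: "a (p + i) = greedy a (n - i)" if "i \<le> n" for i
    using assms(1) that by (auto simp: revocc_def dest: spec[of _ "n - i"])
  have "a (q + n - t) = greedy a t" if "t < n - j" for t
    using eq[rule_format, of "n - t"] p[of "n - t"] that by simp
  then have "q + n \<in> revocc a (greedy a) (n - j)"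
    by (simp add: revocc_def)
  then have "\<not> a (q + n - (n - j)) < greedy a (n - j)"
    using assms(2)[of "n - j"] by simp
  then show "a (p + j) \<le> a (q + j)"
    using p[OF j] j by simp
qed

text \<open>The letter is coded as a singleton set: the unions express existence of \<open>N\<close>
  and \<open>p\<close>, and the intersection over \<open>M\<close> makes the suitable
  \<open>p\<close> unbounded. This is the form to which \<open>env_kernel_range\<close>
  applies.\<close>

lemma greedy_definable:
  assumes "finite (range a)"
  shows "(\<Union>N. \<Inter>M. \<Union>p. if M \<le> p \<and> (\<forall>q. N \<le> q \<longrightarrow> window_le a n p q) then {a p} else {})
    = {greedy a n}"
proof -
  define P where "P c N \<longleftrightarrow> (\<forall>M. \<exists>p\<ge>M. (\<forall>q\<ge>N. window_le a n p q) \<and> a p = c)" for c N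
  have unique: "c = d" if c: "P c N" and d: "P d N'" for c d N N'
  proof -
    \<comment> \<open>Taking \<open>p\<close> beyond \<open>N'\<close> and \<open>q\<close> beyond
      \<open>N\<close> makes each position a competitor of the other, so \<open>window_le\<close>
      holds both ways.\<close>
    obtain p where p: "p \<ge> N'" "\<forall>q\<ge>N. window_le a n p q" "a p = c"
      using c unfolding P_def by blast
    obtain q where q: "q \<ge> N" "\<forall>p\<ge>N'. window_le a n q p" "a q = d"
      using d unfolding P_def by blast
    show ?thesis
      using window_le_antisym[of a n p q] p q by auto
  qed
  have "finite (\<Union>t\<le>n. {r \<in> revocc a (greedy a) t. a (r - t) < greedy a t})"
    using finite_less_greedy[OF assms] by blast
  \<comment> \<open>This \<open>N\<close> lies beyond the finitely many positions where a greedy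
    prefix of length at most \<open>n\<close> is continued by a letter below the greedy one.\<close>
  then obtain N where N:
      "\<forall>r \<in> (\<Union>t\<le>n. {r \<in> revocc a (greedy a) t. a (r - t) < greedy a t}). r < N"
    unfolding finite_nat_set_iff_bounded by blast
  have "P (greedy a n) N"
    unfolding P_def
  proof (intro allI)
    fix M
    obtain r where r: "r \<ge> M + n" "r \<in> revocc a (greedy a) (Suc n)"
      using infinite_revocc_greedy[OF assms, of "Suc n"] by (auto simp: infinite_nat_iff_unbounded_le)
    define p where "p = r - n"
    have p: "p + n \<in> revocc a (greedy a) (Suc n)" "p \<ge> M"
      using r by (auto simp: p_def)
    have "window_le a n p q" if "q \<ge> N" for q
    proof (rule window_le_greedy[OF p(1)])
      fix t assume "t \<le> n"
      show "q + n \<notin> {r \<in> revocc a (greedy a) t. a (r - t) < greedy a t}"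
      proof
        assume "q + n \<in> {r \<in> revocc a (greedy a) t. a (r - t) < greedy a t}"
        then have "q + n < N"
          using N \<open>t \<le> n\<close> by blast
        then show False
          using that by simp
      qed
    qed
    moreover have "a p = greedy a n"
      using p(1) by (auto simp: revocc_def)
    ultimately show "\<exists>p\<ge>M. (\<forall>q\<ge>N. window_le a n p q) \<and> a p = greedy a n"
      using p(2) by blast
  qed
  then have unique_letter: "c = greedy a n \<longleftrightarrow> (\<exists>N. P c N)" for c
    using unique by blast
  have mem: "c \<in> (\<Union>N. \<Inter>M. \<Union>p.
      if M \<le> p \<and> (\<forall>q. N \<le> q \<longrightarrow> window_le a n p q) then {a p} else {}) \<longleftrightarrow> (\<exists>N. P c N)" for c
    by (simp add: P_def if_distrib[of "(\<in>) c"] conj_assoc eq_commute[of c] cong: if_cong)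
  show ?thesis
    by (rule set_eqI) (simp only: mem unique_letter singleton_iff)
qed

lemma finite_kernel_greedy:
  assumes fin: "finite (kernel k a)" and "finite (range a)"
  shows "finite (kernel k (greedy a))"
proof -
  txt \<open>The variables \<open>n, N, M, p, q, j, i\<close> have the indices \<open>0, \<dots>, 6\<close>.\<close>
  let ?F = "\<lambda>f :: (nat \<Rightarrow> nat) \<Rightarrow> bool. finite (env_kernel k f)"
  have le: "?F (\<lambda>v. v i \<le> v j)" for i j
    using env_kernel_map[OF env_kernel_less[of k j i], of Not] by (simp add: not_less)
  have "?F (\<lambda>v. v 5 < v 6 \<and> v 6 \<le> v 0)"
    by (rule env_kernel_comb[OF env_kernel_less le])
  moreover have "?F (\<lambda>v. a (v 3 + v 6) = a (v 4 + v 6))"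
    by (rule env_kernel_comb[OF env_kernel_add[OF fin] env_kernel_add[OF fin]])
  ultimately have "?F (\<lambda>v. v 5 < v 6 \<and> v 6 \<le> v 0 \<longrightarrow> a (v 3 + v 6) = a (v 4 + v 6))"
    by (rule env_kernel_comb)
  from env_kernel_all[OF this, of 6]
  have "?F (\<lambda>v. \<forall>i. v 5 < i \<and> i \<le> v 0 \<longrightarrow> a (v 3 + i) = a (v 4 + i))"
    by simp
  moreover have "?F (\<lambda>v. a (v 3 + v 5) \<le> a (v 4 + v 5))"
    by (rule env_kernel_comb[OF env_kernel_add[OF fin] env_kernel_add[OF fin]])
  ultimately have "?F (\<lambda>v. (\<forall>i. v 5 < i \<and> i \<le> v 0 \<longrightarrow> a (v 3 + i) = a (v 4 + i))
      \<longrightarrow> a (v 3 + v 5) \<le> a (v 4 + v 5))"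
    by (rule env_kernel_comb)
  from env_kernel_all[OF env_kernel_comb[OF le[of 5 0] this, of "(\<longrightarrow>)"], of 5]
  have "?F (\<lambda>v. window_le a (v 0) (v 3) (v 4))"
    by (simp add: window_le_def)
  from env_kernel_all[OF env_kernel_comb[OF le[of 1 4] this, of "(\<longrightarrow>)"], of 4]
  have "?F (\<lambda>v. \<forall>q. v 1 \<le> q \<longrightarrow> window_le a (v 0) (v 3) q)"
    by simp
  from env_kernel_comb[OF env_kernel_comb[OF le[of 2 3] this, of "(\<and>)"] env_kernel_var[OF fin, of 3],
      of "\<lambda>x y. if x then {y} else {}"]
  have "finite (env_kernel k (\<lambda>v :: nat \<Rightarrow> nat.
      if v 2 \<le> v 3 \<and> (\<forall>q. v 1 \<le> q \<longrightarrow> window_le a (v 0) (v 3) q) then {a (v 3)} else {}))" .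
  from env_kernel_range[OF this, of Union 3]
  have "finite (env_kernel k (\<lambda>v :: nat \<Rightarrow> nat. \<Union>p.
      if v 2 \<le> p \<and> (\<forall>q. v 1 \<le> q \<longrightarrow> window_le a (v 0) p q) then {a p} else {}))"
    by simp
  from env_kernel_range[OF this, of Inter 2]
  have "finite (env_kernel k (\<lambda>v :: nat \<Rightarrow> nat. \<Inter>M. \<Union>p.
      if M \<le> p \<and> (\<forall>q. v 1 \<le> q \<longrightarrow> window_le a (v 0) p q) then {a p} else {}))"
    by simp
  from env_kernel_range[OF this, of Union 1]
  have "finite (env_kernel k (\<lambda>v :: nat \<Rightarrow> nat. \<Union>N. \<Inter>M. \<Union>p.
      if M \<le> p \<and> (\<forall>q. N \<le> q \<longrightarrow> window_le a (v 0) p q) then {a p} else {}))"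
    by simp
  \<comment> \<open>The set is now a singleton, and \<open>the_elem\<close> extracts its
    letter.\<close>
  from env_kernel_map[OF this[unfolded greedy_definable[OF assms(2)]], of the_elem]
  have "finite (env_kernel k (\<lambda>v :: nat \<Rightarrow> nat. greedy a (v 0)))"
    by simp
  then show ?thesis
    by (rule finite_kernel_of_env)
qed

lemma greedy_in_range:
  assumes "finite (range a)"
  shows "greedy a n \<in> range a"
proof -
  obtain r where "r \<in> revocc a (greedy a) (Suc n)"
    using infinite_imp_nonempty[OF infinite_revocc_greedy[OF assms]] by blast
  then have "greedy a n = a (r - n)"
    by (simp add: revocc_Suc)
  then show ?thesis
    by simp
qed

theorem theorem8:
  fixes k :: nat and \<Delta> :: "'d::linorder set" and a :: "nat \<Rightarrow> 'd"
  assumes "k \<ge> 2" and "finite \<Delta>" and "automatic k \<Delta> a"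
  shows "(\<exists>!b. lex_least (reverse_orbit_closure a) b) \<and>
         (\<forall>b. lex_least (reverse_orbit_closure a) b \<longrightarrow> automatic k \<Delta> b)"
proof -
  have sub: "range a \<subseteq> \<Delta>"
    using automatic_range[OF assms(1,3)] by blast
  then have fin: "finite (range a)"
    using assms(2) finite_subset by blast
  have "automatic k \<Delta> (greedy a)"
    using finite_kernel_greedy[OF automatic_finite_kernel[OF assms(1,3)] fin]
      greedy_in_range[OF fin] sub
    by (intro finite_kernel_automatic) auto
  then show ?thesis
    using lex_least_greedy[OF fin] lex_least_unique by metis
qed

end
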